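(* Let $f\in S_{\mu,L}(\mathbb{R}^d)$ with minimizer $x^*$ and $f^*=f(x^* )$, and consider the noisy accelerated gradient iterations $$y_k=(1+\beta)x_k-\beta x_{k-1},\qquad x_{k+1}=y_k-\alpha(\nabla f(y_k)+w_k),$$ with stepsize $\alpha$ and momentum parameter $\beta$, where $\{w_k\}$ satisfies the noise assumption of the context. Let $\xi_k=[x_k^\top\;x_{k-1}^\top]^\top$ and let $A,B,C,X_0,X(\rho),\Phi,V_{P,c}$ be as in the context. Assume there exist $\rho\in(0,1)$, a symmetric positive semidefinite $P\in\mathbb{R}^{2d\times2d}$, and $c_0,c\ge0$ such that $$c_0X_0+cX(\rho)\succeq\Phi(A,B,P,\rho).$$ Then for all $k\ge0$, $$\mathbb{E}[V_{P,c}(\xi_k)]\le\rho^{2k}V_{P,c}(\xi_0)+\frac{1-\rho^{2k}}{1-\rho^2}\,\sigma^2\alpha^2\left(\frac c2Ld+\operatorname{Tr}(P_{11})\right),$$ where $P_{11}\in\mathbb{R}^{d\times d}$ is the submatrix of $P$ formed by its first $d$ rows and $d$ columns.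
   Context: For $0<\mu\le L$, $S_{\mu,L}(\mathbb{R}^d)$ is the set of continuously differentiable $f:\mathbb{R}^d\to\mathbb{R}$ with $\frac L2\|x-y\|^2\ge f(x)-f(y)-\nabla f(y)^\top(x-y)\ge\frac\mu2\|x-y\|^2$ for all $x,y$. System matrices: $A=\begin{bmatrix} (1+\beta)I_d & -\beta I_d \\ I_d & 0_d \end{bmatrix}$, $B=\begin{bmatrix} -\alpha I_d \\ 0_d \end{bmatrix}$, $C=[(1+\beta)I_d\;\;-\beta I_d]$, so $\xi_{k+1}=A\xi_k+B(\nabla f(y_k)+w_k)$, $y_k=C\xi_k$. With $\xi^*=[x^{*\top}\;x^{*\top}]^\top$, $V_{P,c}(\xi_k)=(\xi_k-\xi^* )^\top P(\xi_k-\xi^* )+c(f(x_k)-f^* )$. $\Phi(A,B,P,\rho)=\begin{bmatrix} A^\top PA-\rho^2P & A^\top PB \\ B^\top PA & B^\top PB \end{bmatrix}$. $X_0=\begin{bmatrix} 2\mu L\,C^\top C & -(\mu+L)C^\top \\ -(\mu+L)C & 2I_d \end{bmatrix}$. $X(\rho)=\rho^2X_1+(1-\rho^2)X_2$ with $X_j=\tilde X_j\otimes I_d$, $$\tilde X_1=\tfrac12\begin{bmatrix} \beta^2\mu & -\beta^2\mu & -\beta \\ -\beta^2\mu & \beta^2\mu & \beta \\ -\beta & \beta & \alpha(2-L\alpha) \end{bmatrix},\quad \tilde X_2=\tfrac12\begin{bmatrix} (1+\beta)^2\mu & -\beta(1+\beta)\mu & -(1+\beta) \\ -\beta(1+\beta)\mu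 & \beta^2\mu & \beta \\ -(1+\beta) & \beta & \alpha(2-L\alpha) \end{bmatrix}.$$ Noise assumption: for some $\sigma>0$ and every $k\ge0$, the random vector $w_k\in\mathbb{R}^d$ has zero mean, is independent of $\{\xi_i\}_{i=1}^k$ and $\{y_i\}_{i=1}^k$, and $\mathbb{E}[w_kw_k^\top]=\sigma^2I_d$; $x_0,x_{-1}$ are deterministic. $\succeq$ is the positive semidefinite order. *)

theory Defs
  imports "HOL-Probability.Probability"
begin

text \<open>
  The space of dimension \<open>d = CARD('d)\<close> is \<^typ>\<open>real^'d\<close>; block vectors and block matrices
  are indexed by sum types: dimension \<open>2d\<close> is \<^typ>\<open>real^('d + 'd)\<close> and
  the matrices of size \<open>3d\<close> have index type \<^typ>\<open>('d + 'd) + 'd\<close>.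
\<close>

section \<open>Block matrices and the semidefinite order\<close>

text \<open>Since a matrix is a vector of rows, \<open>vstack\<close> stacks vectors as well as matrices.\<close>

definition vstack :: "'a^'m \<Rightarrow> 'a^'n \<Rightarrow> 'a^('m + 'n)" where
  "vstack u v = (\<chi> i. case i of Inl a \<Rightarrow> u $ a | Inr b \<Rightarrow> v $ b)"

definition hstack :: "'a^'m^'r \<Rightarrow> 'a^'n^'r \<Rightarrow> 'a^('m + 'n)^'r" where
  "hstack M N = (\<chi> i. vstack (M $ i) (N $ i))"

definition block_mat ::
  "'a^'m^'r \<Rightarrow> 'a^'n^'r \<Rightarrow> 'a^'m^'s \<Rightarrow> 'a^'n^'s \<Rightarrow> 'a^('m + 'n)^('r + 's)" where
  "block_mat M11 M12 M21 M22 = vstack (hstack M11 M12) (hstack M21 M22)"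

definition upper_block :: "'a^('m + 'n::finite) \<Rightarrow> 'a^'m" where
  "upper_block v = (\<chi> a. v $ Inl a)"

definition upper_left_block :: "'a^('m + 'n::finite)^('r + 's::finite) \<Rightarrow> 'a^'m^'r" where
  "upper_left_block M = (\<chi> a b. M $ Inl a $ Inl b)"

definition psd :: "real^'n^'n \<Rightarrow> bool" where
  "psd M \<longleftrightarrow> transpose M = M \<and> (\<forall>v. 0 \<le> v \<bullet> (M *v v))"

definition loewner_ge :: "real^'n^'n \<Rightarrow> real^'n^'n \<Rightarrow> bool" (infix "\<succeq>" 50) where
  "M \<succeq> N \<longleftrightarrow> psd (M - N)"

definition kronecker :: "real^'n^'m \<Rightarrow> real^'q^'p \<Rightarrow> real^('n \<times> 'q)^('m \<times> 'p)" where
  "kronecker M N = (\<chi> i j. M $ fst i $ fst j * N $ snd i $ snd j)"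

text \<open>Position of an index of \<open>(x_k, x_(k-1), u)\<close> as (number of the block, index in the block).\<close>

fun block3 :: "('d + 'd) + 'd \<Rightarrow> 3 \<times> 'd" where
  "block3 (Inl (Inl a)) = (1, a)"
| "block3 (Inl (Inr a)) = (2, a)"
| "block3 (Inr a) = (3, a)"

definition kronecker_I :: "real^3^3 \<Rightarrow> real^(('d::finite + 'd) + 'd)^(('d + 'd) + 'd)" where
  "kronecker_I M = (\<chi> i j. kronecker M (mat 1 :: real^'d^'d) $ block3 i $ block3 j)"

section \<open>The function class\<close>

definition grad :: "(real^'d \<Rightarrow> real) \<Rightarrow> real^'d \<Rightarrow> real^'d" where
  "grad f x = (THE g. GDERIV f x :> g)"

definition smooth_strongly_convex :: "real \<Rightarrow> real \<Rightarrow> (real^'d \<Rightarrow> real) set" where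
  "smooth_strongly_convex \<mu> L =
    {f. (\<forall>x. f differentiable (at x)) \<and> continuous_on UNIV (grad f) \<and>
        (\<forall>x y. L / 2 * (norm (x - y))\<^sup>2 \<ge> f x - f y - grad f y \<bullet> (x - y) \<and>
               f x - f y - grad f y \<bullet> (x - y) \<ge> \<mu> / 2 * (norm (x - y))\<^sup>2)}"

section \<open>System matrices\<close>

definition sys_A :: "real \<Rightarrow> real^('d::finite + 'd)^('d + 'd)" where
  "sys_A \<beta> = block_mat (mat (1 + \<beta>)) (mat (- \<beta>)) (mat 1) (mat 0)"

definition sys_B :: "real \<Rightarrow> real^'d^('d + 'd)" where
  "sys_B \<alpha> = vstack (mat (- \<alpha>)) (mat 0)"

definition sys_C :: "real \<Rightarrow> real^('d + 'd)^'d" where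
  "sys_C \<beta> = hstack (mat (1 + \<beta>)) (mat (- \<beta>))"

definition Phi ::
  "real^'n^'n \<Rightarrow> real^'m^'n \<Rightarrow> real^'n^'n \<Rightarrow> real \<Rightarrow> real^('n + 'm)^('n + 'm)" where
  "Phi A B P \<rho> = block_mat
     (transpose A ** P ** A - \<rho>\<^sup>2 *\<^sub>R P) (transpose A ** P ** B)
     (transpose B ** P ** A)            (transpose B ** P ** B)"

definition X0_mat :: "real \<Rightarrow> real \<Rightarrow> real \<Rightarrow> real^(('d::finite + 'd) + 'd)^(('d + 'd) + 'd)" where
  "X0_mat \<mu> L \<beta> = (let C = sys_C \<beta> :: real^('d + 'd)^'d in block_mat
     ((2 * \<mu> * L) *\<^sub>R (transpose C ** C)) (- (\<mu> + L) *\<^sub>R transpose C)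
     (- (\<mu> + L) *\<^sub>R C)                  (mat 2))"

definition X1_tilde :: "real \<Rightarrow> real \<Rightarrow> real \<Rightarrow> real \<Rightarrow> real^3^3" where
  "X1_tilde \<mu> L \<alpha> \<beta> = (1 / 2) *\<^sub>R vector
     [vector [  \<beta>\<^sup>2 * \<mu>, - (\<beta>\<^sup>2) * \<mu>, - \<beta>],
      vector [- (\<beta>\<^sup>2) * \<mu>,   \<beta>\<^sup>2 * \<mu>,   \<beta>],
      vector [- \<beta>, \<beta>, \<alpha> * (2 - L * \<alpha>)]]"

definition X2_tilde :: "real \<Rightarrow> real \<Rightarrow> real \<Rightarrow> real \<Rightarrow> real^3^3" where
  "X2_tilde \<mu> L \<alpha> \<beta> = (1 / 2) *\<^sub>R vector
     [vector [(1 + \<beta>)\<^sup>2 * \<mu>, - \<beta> * (1 + \<beta>) * \<mu>, - (1 + \<beta>)],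
      vector [- \<beta> * (1 + \<beta>) * \<mu>, \<beta>\<^sup>2 * \<mu>, \<beta>],
      vector [- (1 + \<beta>), \<beta>, \<alpha> * (2 - L * \<alpha>)]]"

definition X_mat ::
  "real \<Rightarrow> real \<Rightarrow> real \<Rightarrow> real \<Rightarrow> real \<Rightarrow> real^(('d::finite + 'd) + 'd)^(('d + 'd) + 'd)" where
  "X_mat \<mu> L \<alpha> \<beta> \<rho> =
     \<rho>\<^sup>2 *\<^sub>R kronecker_I (X1_tilde \<mu> L \<alpha> \<beta>) + (1 - \<rho>\<^sup>2) *\<^sub>R kronecker_I (X2_tilde \<mu> L \<alpha> \<beta>)"

text \<open>The function \<open>V_fun\<close> takes the state \<open>\<xi>_k\<close> alone: \<open>x_k\<close> is its first block.\<close>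

definition V_fun ::
  "(real^'d \<Rightarrow> real) \<Rightarrow> real^'d \<Rightarrow> real^('d + 'd)^('d + 'd) \<Rightarrow> real \<Rightarrow> real^('d + 'd) \<Rightarrow> real" where
  "V_fun f xstar P c \<xi> =
     (let \<zeta> = \<xi> - vstack xstar xstar in \<zeta> \<bullet> (P *v \<zeta>) + c * (f (upper_block \<xi>) - f xstar))"

section \<open>The noise\<close>

definition outer :: "real^'m \<Rightarrow> real^'n \<Rightarrow> real^'n^'m" where
  "outer u v = (\<chi> i j. u $ i * v $ j)"

text \<open>
  Independence is from the joint vector of all \<open>\<xi>_i\<close> and \<open>y_i\<close> with \<open>1 \<le> i \<le> k\<close>, for \<open>k = 0\<close>
  from the trivial \<open>\<sigma>\<close>-algebra. It is stated with the generated \<open>\<sigma>\<close>-algebras because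
  \<open>prob_space.indep_var\<close> requires both variables to have the same type. The integrability
  requirements make the two moments genuine: a Bochner integral is 0 where it does not exist.
\<close>

definition noise ::
  "'a measure \<Rightarrow> real \<Rightarrow> (nat \<Rightarrow> 'a \<Rightarrow> real^('d + 'd)) \<Rightarrow> (nat \<Rightarrow> 'a \<Rightarrow> real^'d) \<Rightarrow>
   (nat \<Rightarrow> 'a \<Rightarrow> real^'d) \<Rightarrow> bool" where
  "noise M \<sigma> \<xi> y w \<longleftrightarrow> (\<forall>k.
     integrable M (w k) \<and> (\<integral>\<omega>. w k \<omega> \<partial>M) = 0 \<and>
     integrable M (\<lambda>\<omega>. outer (w k \<omega>) (w k \<omega>)) \<and>
     (\<integral>\<omega>. outer (w k \<omega>) (w k \<omega>) \<partial>M) = \<sigma>\<^sup>2 *\<^sub>R mat 1 \<and>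
     prob_space.indep_set M
       (sets (vimage_algebra (space M) (w k) borel))
       (sets (vimage_algebra (space M) (\<lambda>\<omega>. \<lambda>i\<in>{1..k}. (\<xi> i \<omega>, y i \<omega>))
         (Pi\<^sub>M {1..k} (\<lambda>_. borel \<Otimes>\<^sub>M borel)))))"

end

theory Submission
  imports Defs
begin

text \<open>
  Paired with the vector \<open>(\<xi>_k - \<xi>^*, g)\<close>, where \<open>g\<close> is the gradient of \<open>f\<close> at \<open>y_k\<close>, the form of
  \<open>X_0\<close> is nonpositive by cocoercivity of the gradient, while those of \<open>X_1\<close> and \<open>X_2\<close> bound the
  decrease of \<open>f\<close> along the noiseless step relative to \<open>f(x_k)\<close> and \<open>f^*\<close>, by strong convexity
  between \<open>y_k\<close> and \<open>x_k\<close>, respectively \<open>x^*\<close>. The matrix inequality therefore makes \<open>V\<close> contract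
  by \<open>\<rho>^2\<close> along the noiseless step. The noise adds a term linear in \<open>w_k\<close>, which has mean zero
  because its coefficient is a function of \<open>\<xi>_k\<close>, and a quadratic term with the expectation
  \<open>\<sigma>^2 \<alpha>^2 (c L d / 2 + Tr P_11)\<close>; the bound follows by summing a geometric series.
\<close>

section \<open>Block vectors and quadratic forms\<close>

lemma sum_UNIV_plus:
  fixes h :: "'a::finite + 'b::finite \<Rightarrow> 'c::comm_monoid_add"
  shows "(\<Sum>i\<in>UNIV. h i) = (\<Sum>a\<in>UNIV. h (Inl a)) + (\<Sum>b\<in>UNIV. h (Inr b))"
  using sum.Plus[of "UNIV :: 'a set" "UNIV :: 'b set" h] by (simp add: UNIV_Plus_UNIV comp_def)

lemma vstack_nth [simp]:
  "vstack u v $ Inl a = u $ a" "vstack u v $ Inr b = v $ b"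
  by (simp_all add: vstack_def)

lemma hstack_nth [simp]:
  "hstack M N $ i $ Inl a = M $ i $ a" "hstack M N $ i $ Inr b = N $ i $ b"
  by (simp_all add: hstack_def)

lemma upper_block_vstack [simp]: "upper_block (vstack u v) = u"
  by (simp add: upper_block_def vec_eq_iff)

lemma vec_eq_plus_iff:
  "u = v \<longleftrightarrow> (\<forall>a. u $ Inl a = v $ Inl a) \<and> (\<forall>b. u $ Inr b = v $ Inr b)"
  by (metis sum.exhaust vec_eq_iff)

lemma vstack_cases:
  obtains u v where "z = vstack u v"
proof
  show "z = vstack (\<chi> a. z $ Inl a) (\<chi> b. z $ Inr b)" by (simp add: vec_eq_plus_iff)
qed

lemma vstack_add: "vstack u v + vstack u' v' = vstack (u + u') (v + v')"
  by (simp add: vec_eq_plus_iff)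

lemma vstack_diff: "vstack u v - vstack u' v' = vstack (u - u') (v - v')"
  by (simp add: vec_eq_plus_iff)

lemma inner_vstack:
  fixes u u' :: "real^'m" and v v' :: "real^'n"
  shows "vstack u v \<bullet> vstack u' v' = u \<bullet> u' + v \<bullet> v'"
  by (simp add: inner_vec_def sum_UNIV_plus)

lemma norm_upper_block_le:
  fixes z :: "real^('m::finite + 'n::finite)"
  shows "norm (upper_block z) \<le> norm z"
proof -
  obtain u v where "z = vstack u v" by (rule vstack_cases)
  then show ?thesis by (simp add: norm_le inner_vstack)
qed

lemma hstack_mult_vstack:
  fixes M :: "real^'m^'r" and N :: "real^'n^'r"
  shows "hstack M N *v vstack u v = M *v u + N *v v"
  by (simp add: vec_eq_iff matrix_vector_mult_def sum_UNIV_plus)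

lemma vstack_mult:
  fixes M :: "real^'m^'r" and N :: "real^'m^'s"
  shows "vstack M N *v u = vstack (M *v u) (N *v u)"
  by (simp add: vec_eq_plus_iff matrix_vector_mult_def)

lemma mat_mult_vec: "mat k *v (u :: real^'m) = k *\<^sub>R u"
  by (simp add: vec_eq_iff matrix_vector_mult_def mat_def if_distrib[where f = "\<lambda>a. a * _"] cong: if_cong)

lemma block_mat_mult_vstack:
  fixes M11 :: "real^'m^'r" and M12 :: "real^'n^'r" and M21 :: "real^'m^'s" and M22 :: "real^'n^'s"
  shows "block_mat M11 M12 M21 M22 *v vstack u v
    = vstack (M11 *v u + M12 *v v) (M21 *v u + M22 *v v)"
  by (simp add: block_mat_def vstack_mult hstack_mult_vstack)

text \<open>The adjoint identity in the form in which it is met: the simplifier rewrites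
  \<open>transpose A *v v\<close> to \<open>v v* A\<close>.\<close>

lemma inner_vector_matrix_mult:
  fixes A :: "real^'n^'m"
  shows "u \<bullet> (v v* A) = (A *v u) \<bullet> v"
  using dot_lmul_matrix[of v A u] by (simp add: inner_commute)

lemma psd_inner_commute:
  assumes "psd P"
  shows "u \<bullet> (P *v v) = v \<bullet> (P *v u)"
  using assms inner_vector_matrix_mult[of u v P] by (metis inner_commute psd_def transpose_matrix_vector)

lemma psd_quadratic_add:
  assumes "psd P"
  shows "(u + v) \<bullet> (P *v (u + v)) = u \<bullet> (P *v u) + 2 * (v \<bullet> (P *v u)) + v \<bullet> (P *v v)"
  using psd_inner_commute[OF assms, of u v]
  by (simp add: matrix_vector_right_distrib inner_add_left inner_add_right)

lemma loewner_ge_inner: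
  assumes "M \<succeq> N"
  shows "v \<bullet> (N *v v) \<le> v \<bullet> (M *v v)"
  using assms by (simp add: loewner_ge_def psd_def matrix_vector_mult_diff_rdistrib inner_diff_right)

section \<open>Quadratic forms of the matrices in the linear matrix inequality\<close>

text \<open>For \<open>z\<close> the deviation of the state from its limit and \<open>g\<close> the
  gradient at y_k, \<open>A *v z + B *v g\<close> is the deviation after a noiseless step. The form
  is thus the P-part of V after that step minus \<rho>^2 times its present value.\<close>

lemma inner_Phi:
  fixes A :: "real^'n^'n" and B :: "real^'m^'n"
  shows "vstack z g \<bullet> (Phi A B P \<rho> *v vstack z g)
    = (A *v z + B *v g) \<bullet> (P *v (A *v z + B *v g)) - \<rho>\<^sup>2 * (z \<bullet> (P *v z))"
  by (simp add: Phi_def block_mat_mult_vstack inner_vstack matrix_vector_mult_diff_rdistrib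
      matrix_vector_mul_assoc[symmetric] inner_add_left inner_add_right inner_diff_right
      inner_vector_matrix_mult matrix_vector_right_distrib scaleR_matrix_vector_assoc[symmetric])

text \<open>With \<open>s\<close> = y_k - x^* and \<open>g\<close> the gradient at y_k, this is
  twice the difference of the two sides of cocoercivity between y_k and x^*, where the gradient
  vanishes.\<close>

lemma inner_X0_mat:
  fixes g :: "real^'d" and z :: "real^('d + 'd)" and \<beta> :: real
  defines "s \<equiv> sys_C \<beta> *v z"
  shows "vstack z g \<bullet> (X0_mat \<mu> L \<beta> *v vstack z g)
    = 2 * \<mu> * L * (s \<bullet> s) - 2 * (\<mu> + L) * (g \<bullet> s) + 2 * (g \<bullet> g)"
proof -
  have "s \<bullet> g = g \<bullet> s" by (rule inner_commute)
  then show ?thesis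
    unfolding s_def
    by (simp add: X0_mat_def Let_def block_mat_mult_vstack inner_vstack
        matrix_vector_mul_assoc[symmetric] inner_add_right mat_mult_vec inner_minus_right
        scaleR_matrix_vector_assoc[symmetric] inner_vector_matrix_mult
        del: scaleR_minus_left minus_add_distrib)
qed

text \<open>The identity factor of the Kronecker product kills all mixed coordinates, so
  \<open>T\<close> acts on the three blocks as if they were scalars.\<close>

lemma kronecker_I_mult:
  fixes u v g :: "real^'d" and \<beta> :: real
  shows "kronecker_I T *v vstack (vstack u v) g
    = vstack (vstack (T$1$1 *\<^sub>R u + T$1$2 *\<^sub>R v + T$1$3 *\<^sub>R g)
                     (T$2$1 *\<^sub>R u + T$2$2 *\<^sub>R v + T$2$3 *\<^sub>R g))
             (T$3$1 *\<^sub>R u + T$3$2 *\<^sub>R v + T$3$3 *\<^sub>R g)"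
proof -
  have delta: "(\<Sum>a\<in>UNIV. t * (if b = a then 1 else 0) * h a) = t * h b"
    for t :: real and b :: 'd and h
    by (simp add: if_distrib[where f = "\<lambda>a. _ * a * _"] cong: if_cong)
  show ?thesis
    by (simp add: vec_eq_plus_iff kronecker_I_def kronecker_def matrix_vector_mult_def
      sum_UNIV_plus mat_def delta split_sum_all)
qed

text \<open>For \<open>u\<close>, \<open>v\<close> the deviations of x_k, x_(k-1) from x^*,
  \<open>\<beta> *\<^sub>R (u - v)\<close> is y_k - x_k. The first two terms are then the strong
  convexity lower bound for f(x_k) - f(y_k); the last is the decrease that the quadratic upper bound
  guarantees for a gradient step of length \<alpha> from y_k.\<close>

lemma inner_X1_tilde:
  "vstack (vstack u v) g \<bullet> (kronecker_I (X1_tilde \<mu> L \<alpha> \<beta>) *v vstack (vstack u v) g)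
   = \<mu> / 2 * ((\<beta> *\<^sub>R (u - v)) \<bullet> (\<beta> *\<^sub>R (u - v))) - g \<bullet> (\<beta> *\<^sub>R (u - v)) + \<alpha> * (1 - L * \<alpha> / 2) * (g \<bullet> g)"
  by (simp add: kronecker_I_mult inner_vstack X1_tilde_def inner_add_right inner_diff_right
      inner_diff_left inner_commute power2_eq_square field_simps)

text \<open>The same reading with x^* in place of x_k: \<open>s\<close> is y_k - x^*.\<close>

lemma inner_X2_tilde:
  fixes u v g :: "real^'d" and \<beta> :: real
  defines "s \<equiv> (1 + \<beta>) *\<^sub>R u - \<beta> *\<^sub>R v"
  shows "vstack (vstack u v) g \<bullet> (kronecker_I (X2_tilde \<mu> L \<alpha> \<beta>) *v vstack (vstack u v) g)
   = \<mu> / 2 * (s \<bullet> s) - g \<bullet> s + \<alpha> * (1 - L * \<alpha> / 2) * (g \<bullet> g)"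
  unfolding s_def
  by (simp add: kronecker_I_mult inner_vstack X2_tilde_def inner_add_right inner_diff_right
      inner_diff_left inner_commute power2_eq_square field_simps)

lemma inner_X_mat:
  "e \<bullet> (X_mat \<mu> L \<alpha> \<beta> \<rho> *v e) = \<rho>\<^sup>2 * (e \<bullet> (kronecker_I (X1_tilde \<mu> L \<alpha> \<beta>) *v e))
     + (1 - \<rho>\<^sup>2) * (e \<bullet> (kronecker_I (X2_tilde \<mu> L \<alpha> \<beta>) *v e))"
  by (simp add: X_mat_def matrix_vector_mult_add_rdistrib inner_add_right
      scaleR_matrix_vector_assoc[symmetric])

lemma sys_A_mult: "sys_A \<beta> *v vstack u v = vstack ((1 + \<beta>) *\<^sub>R u - \<beta> *\<^sub>R v) u"
  by (simp add: sys_A_def block_mat_mult_vstack mat_mult_vec)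

lemma sys_B_mult: "sys_B \<alpha> *v w = vstack (- \<alpha> *\<^sub>R w) 0"
  by (simp add: sys_B_def vstack_mult mat_mult_vec)

lemma sys_C_mult: "sys_C \<beta> *v vstack u v = (1 + \<beta>) *\<^sub>R u - \<beta> *\<^sub>R v"
  by (simp add: sys_C_def hstack_mult_vstack mat_mult_vec)

lemma inner_upper_left_block:
  fixes u :: "real^'d" and P :: "real^('d + 'd)^('d + 'd)"
  shows "vstack u 0 \<bullet> (P *v vstack u 0) = u \<bullet> (upper_left_block P *v u)"
  by (simp add: inner_vec_def sum_UNIV_plus matrix_vector_mult_def upper_left_block_def)

text \<open>The noise enters only the first block of the state, so it meets only P_11; this is the
  source of the trace term.\<close>

lemma sys_B_quadratic:
  "(sys_B \<alpha> *v w) \<bullet> (P *v (sys_B \<alpha> *v w)) = \<alpha>\<^sup>2 * (w \<bullet> (upper_left_block P *v w))"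
  by (simp add: sys_B_mult inner_upper_left_block matrix_vector_mult_scaleR power2_eq_square
      del: scaleR_minus_left)

section \<open>Smooth strongly convex functions\<close>

text \<open>Inner products replace the squared norms so that, once expanded, later estimates are
  linear in the inner products.\<close>

lemma smooth_strongly_convexD:
  assumes "f \<in> smooth_strongly_convex \<mu> L"
  shows "f x \<le> f y + grad f y \<bullet> (x - y) + L / 2 * ((x - y) \<bullet> (x - y))"
    and "f y + grad f y \<bullet> (x - y) + \<mu> / 2 * ((x - y) \<bullet> (x - y)) \<le> f x"
proof -
  have "L / 2 * (norm (x - y))\<^sup>2 \<ge> f x - f y - grad f y \<bullet> (x - y) \<and>
    f x - f y - grad f y \<bullet> (x - y) \<ge> \<mu> / 2 * (norm (x - y))\<^sup>2"
    using assms unfolding smooth_strongly_convex_def by blast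
  then show "f x \<le> f y + grad f y \<bullet> (x - y) + L / 2 * ((x - y) \<bullet> (x - y))"
    and "f y + grad f y \<bullet> (x - y) + \<mu> / 2 * ((x - y) \<bullet> (x - y)) \<le> f x"
    unfolding power2_norm_eq_inner by linarith+
qed

lemma smooth_strongly_convex_borel:
  assumes "f \<in> smooth_strongly_convex \<mu> L"
  shows "f \<in> borel_measurable borel" "grad f \<in> borel_measurable borel"
proof -
  have "continuous_on UNIV f"
    using assms differentiable_imp_continuous_within
    by (auto simp: smooth_strongly_convex_def continuous_on_eq_continuous_within)
  then show "f \<in> borel_measurable borel"
    by (rule borel_measurable_continuous_onI)
  show "grad f \<in> borel_measurable borel"
    using assms by (auto simp: smooth_strongly_convex_def intro: borel_measurable_continuous_onI)
qed

text \<open>By the quadratic upper bound, a gradient step of length 1/L lowers f by at least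
  |grad|^2 / (2L), which is impossible at a minimizer unless the gradient is zero.\<close>

lemma grad_minimizer:
  assumes "f \<in> smooth_strongly_convex \<mu> L" "0 < L" "\<And>z. f xs \<le> f z"
  shows "grad f xs = 0"
proof -
  let ?g = "grad f xs"
  have "f xs \<le> f (xs - (1 / L) *\<^sub>R ?g)" by (rule assms)
  also have "\<dots> \<le> f xs + ?g \<bullet> (- (1 / L) *\<^sub>R ?g) + L / 2 * ((- (1 / L) *\<^sub>R ?g) \<bullet> (- (1 / L) *\<^sub>R ?g))"
    using smooth_strongly_convexD(1)[OF assms(1), of "xs - (1 / L) *\<^sub>R ?g" xs] by simp
  also have "\<dots> = f xs - 1 / (2 * L) * (?g \<bullet> ?g)"
    using \<open>0 < L\<close> by (simp add: field_simps)
  finally have "1 / (2 * L) * (?g \<bullet> ?g) \<le> 0" by simp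
  then have "?g \<bullet> ?g \<le> 0"
    using \<open>0 < L\<close> by (simp add: divide_le_0_iff)
  then show ?thesis
    using inner_gt_zero_iff[of ?g] by linarith
qed

text \<open>In the proof, \<open>z\<close> is a gradient step of length \<open>t\<close> for the convex function
  \<open>f - \<mu>/2 |.|^2\<close> tilted at \<open>b\<close>, and \<open>t = 1 / (L - \<mu>)\<close> is optimal. For \<open>L = \<mu>\<close> letting \<open>t\<close>
  grow forces \<open>q = 0\<close>.\<close>

lemma smooth_strongly_convex_cocoercive:
  assumes f: "f \<in> smooth_strongly_convex \<mu> L" and "\<mu> \<le> L"
  shows "\<mu> * L * ((x - y) \<bullet> (x - y)) + (grad f x - grad f y) \<bullet> (grad f x - grad f y)
    \<le> (\<mu> + L) * ((grad f x - grad f y) \<bullet> (x - y))"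
proof -
  define p where "p = x - y"
  define q where "q = grad f x - grad f y - \<mu> *\<^sub>R p"
  have half: "(t - (L - \<mu>) / 2 * t\<^sup>2) * (q' \<bullet> q')
      \<le> f a - f b - grad f b \<bullet> (a - b) - \<mu> / 2 * ((a - b) \<bullet> (a - b))"
    if "q' = grad f a - grad f b - \<mu> *\<^sub>R (a - b)" for a b q' t
  proof -
    define z where "z = a - t *\<^sub>R q'"
    have ga: "grad f a = q' + grad f b + \<mu> *\<^sub>R (a - b)"
      using that by simp
    have za: "z - a = - t *\<^sub>R q'" and zb: "z - b = (a - b) - t *\<^sub>R q'"
      by (simp_all add: z_def)
    \<comment> \<open>The upper bound based at \<open>a\<close> and the lower bound based at
      \<open>b\<close>, both evaluated at \<open>z\<close>, are chained through
      \<open>f z\<close>.\<close>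
    show ?thesis
      using smooth_strongly_convexD(1)[OF f, of z a] smooth_strongly_convexD(2)[OF f, of b z]
      unfolding za zb ga
      by (simp add: inner_add_left inner_add_right inner_diff_left inner_diff_right inner_commute
          power2_eq_square field_simps)
  qed
  \<comment> \<open>Adding \<open>half\<close> for both orders of \<open>x\<close> and
    \<open>y\<close>, where \<open>q\<close> changes sign, cancels the function values and leaves
    \<open>q \<bullet> p\<close> on the right.\<close>
  have both: "(2 * t - (L - \<mu>) * t\<^sup>2) * (q \<bullet> q) \<le> q \<bullet> p" for t
    using half[of q x y t] half[of "- q" y x t]
    unfolding q_def p_def
    by (simp add: inner_add_left inner_add_right inner_diff_left inner_diff_right inner_commute
          power2_eq_square field_simps)
  have "q \<bullet> q \<le> (L - \<mu>) * (q \<bullet> p)"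
  proof (cases "L = \<mu>")
    case True
    have "q \<bullet> q = 0"
    proof (rule ccontr)
      assume "q \<bullet> q \<noteq> 0"
      then have "0 < q \<bullet> q" by (metis inner_gt_zero_iff inner_zero_left)
      \<comment> \<open>For this value of \<open>t\<close> the left side of \<open>both\<close> is
        2(|q.p| + 1), which exceeds q.p.\<close>
      then have "2 * ((\<bar>q \<bullet> p\<bar> + 1) / (q \<bullet> q)) * (q \<bullet> q) = 2 * (\<bar>q \<bullet> p\<bar> + 1)" by simp
      with both[of "(\<bar>q \<bullet> p\<bar> + 1) / (q \<bullet> q)"] True show False by simp
    qed
    with True show ?thesis by simp
  next
    case False
    then have pos: "0 < L - \<mu>" using \<open>\<mu> \<le> L\<close> by simp
    \<comment> \<open>Here \<open>t\<close> stands for L - \<mu>, the reciprocal of the step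
      length.\<close>
    have "2 * (1 / t) - t * (1 / t)\<^sup>2 = 1 / t" if "0 < t" for t :: real
      using that by (simp add: power2_eq_square)
    from both[of "1 / (L - \<mu>)", unfolded this[OF pos]] show ?thesis
      using pos by (simp add: pos_divide_le_eq mult.commute)
  qed
  \<comment> \<open>Substituting this into the claim and cancelling turns it into exactly the bound
    just proved for \<open>q \<bullet> q\<close>.\<close>
  moreover have "grad f x - grad f y = q + \<mu> *\<^sub>R p" by (simp add: q_def)
  ultimately show ?thesis
    unfolding p_def[symmetric]
    by (simp add: inner_add_left inner_add_right inner_commute power2_eq_square algebra_simps)
qed

text \<open>Cocoercivity without its nonnegative term \<mu> L |x - y|^2, followed by Cauchy-Schwarz.
  The constant is not sharp; linear growth is all that square integrability of the gradient
  requires.\<close>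

lemma norm_grad_le:
  assumes f: "f \<in> smooth_strongly_convex \<mu> L" and "0 < \<mu>" "\<mu> \<le> L"
  shows "norm (grad f x - grad f y) \<le> (\<mu> + L) * norm (x - y)"
proof -
  define q where "q = grad f x - grad f y"
  have "0 \<le> \<mu> * L * ((x - y) \<bullet> (x - y))" using assms by simp
  then have "q \<bullet> q \<le> (\<mu> + L) * (q \<bullet> (x - y))"
    using smooth_strongly_convex_cocoercive[OF f \<open>\<mu> \<le> L\<close>, of x y] unfolding q_def by linarith
  also have "\<dots> \<le> (\<mu> + L) * (norm q * norm (x - y))"
    using assms by (intro mult_left_mono norm_cauchy_schwarz) auto
  finally have "norm q * norm q \<le> norm q * ((\<mu> + L) * norm (x - y))"
    by (simp add: power2_norm_eq_inner[symmetric] power2_eq_square mult_ac)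
  then show ?thesis
    using assms unfolding q_def[symmetric] by (cases "norm q = 0") (auto simp: mult_le_cancel_left)
qed

section \<open>One step of the iteration\<close>

text \<open>The noiseless step on the stacked state; the true step adds
  \<open>sys_B \<alpha> *v w\<close> to it.\<close>

definition agd_map :: "(real^'d \<Rightarrow> real) \<Rightarrow> real \<Rightarrow> real \<Rightarrow> real^('d + 'd) \<Rightarrow> real^('d + 'd)" where
  "agd_map f \<alpha> \<beta> z = sys_A \<beta> *v z + sys_B \<alpha> *v grad f (sys_C \<beta> *v z)"

text \<open>The vector paired with the noise when V is expanded at the next state. The first summand
  is the cross term of the P-form. In the second, -\<alpha> comes from the linear term and L
  \<alpha>^2 from the square in the quadratic upper bound for f.\<close>

definition noise_coeff ::
  "(real^'d \<Rightarrow> real) \<Rightarrow> real^'d \<Rightarrow> real \<Rightarrow> real \<Rightarrow> real \<Rightarrow> real^('d + 'd)^('d + 'd) \<Rightarrow> real \<Rightarrow>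
   real^('d + 'd) \<Rightarrow> real^'d" where
  "noise_coeff f xs L \<alpha> \<beta> P c z =
     2 *\<^sub>R (transpose (sys_B \<alpha>) *v (P *v (agd_map f \<alpha> \<beta> z - vstack xs xs)))
     + (c * (L * \<alpha>\<^sup>2 - \<alpha>)) *\<^sub>R grad f (sys_C \<beta> *v z)"

text \<open>\<open>sys_A \<beta>\<close> fixes the stacked vector of x^* with itself, since (1 +
  \<beta>) - \<beta> = 1, so deviations follow the same linear system.\<close>

lemma agd_map_diff:
  "agd_map f \<alpha> \<beta> z - vstack xs xs
     = sys_A \<beta> *v (z - vstack xs xs) + sys_B \<alpha> *v grad f (sys_C \<beta> *v z)"
  by (simp add: agd_map_def matrix_vector_mult_diff_distrib sys_A_mult algebra_simps)

text \<open>A deterministic estimate, valid for every state and every noise value; probability is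
  needed only to average its last two summands.\<close>

lemma V_fun_step:
  fixes w :: "real^'d" and z :: "real^('d + 'd)"
  assumes mu: "0 < \<mu>" "\<mu> \<le> L" and f: "f \<in> smooth_strongly_convex \<mu> L"
    and min: "\<And>x. f xs \<le> f x" and P: "psd P" and \<rho>: "0 < \<rho>" "\<rho> < 1" and c: "0 \<le> c0" "0 \<le> c"
    and LMI: "c0 *\<^sub>R X0_mat \<mu> L \<beta> + c *\<^sub>R X_mat \<mu> L \<alpha> \<beta> \<rho> \<succeq> Phi (sys_A \<beta>) (sys_B \<alpha>) P \<rho>"
  shows "V_fun f xs P c (agd_map f \<alpha> \<beta> z + sys_B \<alpha> *v w)
    \<le> \<rho>\<^sup>2 * V_fun f xs P c z + noise_coeff f xs L \<alpha> \<beta> P c z \<bullet> w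
      + \<alpha>\<^sup>2 * (c / 2 * L * (w \<bullet> w) + w \<bullet> (upper_left_block P *v w))"
proof -
  obtain x x' where z: "z = vstack x x'" by (rule vstack_cases)
  define u v where "u = x - xs" and "v = x' - xs"
  define y where "y = (1 + \<beta>) *\<^sub>R x - \<beta> *\<^sub>R x'"
  define s where "s = (1 + \<beta>) *\<^sub>R u - \<beta> *\<^sub>R v"
  define g where "g = grad f y"
  define \<zeta> where "\<zeta> = vstack u v"
  define \<zeta>' where "\<zeta>' = agd_map f \<alpha> \<beta> z - vstack xs xs"
  define e where "e = vstack \<zeta> g"
  \<comment> \<open>\<open>D\<close> is the quadratic upper bound for f at the noiseless successor
    \<open>y - \<alpha> *\<^sub>R g\<close>.\<close>
  define D where "D = f y - \<alpha> * (1 - L * \<alpha> / 2) * (g \<bullet> g)"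
  have y: "sys_C \<beta> *v z = y" by (simp add: z y_def sys_C_mult)
  have s: "y - xs = s" by (simp add: y_def s_def u_def v_def algebra_simps)
  have yx: "x - y = - (\<beta> *\<^sub>R (u - v))" by (simp add: y_def u_def v_def algebra_simps)
  have \<zeta>: "z - vstack xs xs = \<zeta>" by (simp add: z \<zeta>_def u_def v_def vstack_diff)
  have \<zeta>': "\<zeta>' = sys_A \<beta> *v \<zeta> + sys_B \<alpha> *v g"
    by (simp add: \<zeta>'_def agd_map_diff \<zeta> y g_def)
  have "0 < L" using mu by simp
  have g0: "grad f xs = 0" by (rule grad_minimizer[OF f \<open>0 < L\<close> min])

  \<comment> \<open>By \<open>g0\<close>, \<open>g\<close> is the gradient difference between
    \<open>y\<close> and \<open>xs\<close>, to which cocoercivity applies.\<close>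
  have X0: "e \<bullet> (X0_mat \<mu> L \<beta> *v e) \<le> 0"
  proof -
    have Cz: "sys_C \<beta> *v \<zeta> = s" by (simp add: \<zeta>_def sys_C_mult s_def)
    show ?thesis
      using smooth_strongly_convex_cocoercive[OF f mu(2), of y xs]
      unfolding e_def inner_X0_mat Cz by (simp add: g0 s g_def[symmetric] algebra_simps)
  qed
  have X1: "D
      \<le> f x - e \<bullet> (kronecker_I (X1_tilde \<mu> L \<alpha> \<beta>) *v e)"
    using smooth_strongly_convexD(2)[OF f, of y x]
    unfolding D_def e_def \<zeta>_def inner_X1_tilde yx g_def[symmetric] by simp
  have X2: "D
      \<le> f xs - e \<bullet> (kronecker_I (X2_tilde \<mu> L \<alpha> \<beta>) *v e)"
  proof -
    have "xs - y = - s" by (simp add: s[symmetric])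
    then show ?thesis
      using smooth_strongly_convexD(2)[OF f, of y xs]
      unfolding D_def e_def \<zeta>_def inner_X2_tilde s_def[symmetric] g_def[symmetric] by simp
  qed
  \<comment> \<open>\<open>X1\<close> and \<open>X2\<close> are averaged with the weights \<rho>^2
    and 1 - \<rho>^2 that define \<open>X_mat\<close>; the values \<open>f xs\<close> then combine
    to leave \<rho>^2 (f x - f xs).\<close>
  have X: "D - f xs
      \<le> \<rho>\<^sup>2 * (f x - f xs) - e \<bullet> (X_mat \<mu> L \<alpha> \<beta> \<rho> *v e)"
  proof -
    have "0 \<le> \<rho>\<^sup>2" "0 \<le> 1 - \<rho>\<^sup>2" using \<rho> by (simp_all add: power_le_one)
    from add_mono[OF mult_left_mono[OF X1 this(1)] mult_left_mono[OF X2 this(2)]]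
    show ?thesis by (simp add: inner_X_mat algebra_simps)
  qed
  have Phi: "\<zeta>' \<bullet> (P *v \<zeta>') - \<rho>\<^sup>2 * (\<zeta> \<bullet> (P *v \<zeta>)) \<le> c * (e \<bullet> (X_mat \<mu> L \<alpha> \<beta> \<rho> *v e))"
  proof -
    have "c0 * (e \<bullet> (X0_mat \<mu> L \<beta> *v e)) \<le> 0"
      using X0 c by (simp add: mult_nonneg_nonpos)
    with loewner_ge_inner[OF LMI, of e] show ?thesis
      by (simp add: matrix_vector_mult_add_rdistrib inner_add_right
          scaleR_matrix_vector_assoc[symmetric] e_def inner_Phi \<zeta>')
  qed
  \<comment> \<open>The form of \<open>X_mat\<close> at \<open>e\<close> cancels between
    \<open>Phi\<close> and c times \<open>X\<close>.\<close>
  have det: "\<zeta>' \<bullet> (P *v \<zeta>') + c * (D - f xs)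
      \<le> \<rho>\<^sup>2 * V_fun f xs P c z"
    using mult_left_mono[OF X c(2)] Phi
    by (simp add: V_fun_def Let_def \<zeta> z[symmetric] algebra_simps) (simp add: z)
  have x_next: "upper_block (agd_map f \<alpha> \<beta> z + sys_B \<alpha> *v w) = y - \<alpha> *\<^sub>R (g + w)"
    unfolding agd_map_def y g_def[symmetric] unfolding z sys_A_mult sys_B_mult y_def[symmetric]
    by (simp add: vstack_add scaleR_add_right)
  \<comment> \<open>The quadratic upper bound based at \<open>y\<close>, now at the noisy successor:
    the terms without \<open>w\<close> make up \<open>D\<close>.\<close>
  have fnext: "f (y - \<alpha> *\<^sub>R (g + w)) \<le> D      + (L * \<alpha>\<^sup>2 - \<alpha>) * (g \<bullet> w) + L / 2 * \<alpha>\<^sup>2 * (w \<bullet> w)"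
  proof -
    define x1 where "x1 = y - \<alpha> *\<^sub>R (g + w)"
    have "x1 - y = - (\<alpha> *\<^sub>R (g + w))" by (simp add: x1_def)
    with smooth_strongly_convexD(1)[OF f, of x1 y]
    have "f x1 \<le> f y + g \<bullet> (- (\<alpha> *\<^sub>R (g + w)))
        + L / 2 * ((\<alpha> *\<^sub>R (g + w)) \<bullet> (\<alpha> *\<^sub>R (g + w)))"
      by (simp add: g_def)
    then show ?thesis
      unfolding x1_def[symmetric] D_def
      by (simp add: inner_add_left inner_add_right inner_diff_right inner_commute[of w g] power2_eq_square field_simps)
  qed
  have quad: "(\<zeta>' + sys_B \<alpha> *v w) \<bullet> (P *v (\<zeta>' + sys_B \<alpha> *v w))
     = \<zeta>' \<bullet> (P *v \<zeta>') + 2 * ((transpose (sys_B \<alpha>) *v (P *v \<zeta>')) \<bullet> w)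
       + \<alpha>\<^sup>2 * (w \<bullet> (upper_left_block P *v w))"
    using inner_vector_matrix_mult[of w "P *v \<zeta>'" "sys_B \<alpha>"]
    unfolding psd_quadratic_add[OF P] sys_B_quadratic by (simp add: inner_commute)
  have "agd_map f \<alpha> \<beta> z + sys_B \<alpha> *v w - vstack xs xs = \<zeta>' + sys_B \<alpha> *v w"
    by (simp add: \<zeta>'_def)
  then have "V_fun f xs P c (agd_map f \<alpha> \<beta> z + sys_B \<alpha> *v w)
    = (\<zeta>' + sys_B \<alpha> *v w) \<bullet> (P *v (\<zeta>' + sys_B \<alpha> *v w)) + c * (f (y - \<alpha> *\<^sub>R (g + w)) - f xs)"
    by (simp only: V_fun_def Let_def x_next)
  also have "c * (f (y - \<alpha> *\<^sub>R (g + w)) - f xs)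
      \<le> c * ((D - f xs) + (L * \<alpha>\<^sup>2 - \<alpha>) * (g \<bullet> w) + L / 2 * \<alpha>\<^sup>2 * (w \<bullet> w))"
    using fnext c(2) by (intro mult_left_mono) auto
  also have "\<dots> = c * (D - f xs) + c * (L * \<alpha>\<^sup>2 - \<alpha>) * (g \<bullet> w) + \<alpha>\<^sup>2 * (c / 2 * L * (w \<bullet> w))"
    by (simp add: algebra_simps)
  finally show ?thesis
    using det unfolding quad noise_coeff_def \<zeta>'_def[symmetric] y g_def[symmetric]
    by (simp add: inner_add_left distrib_left)
qed

section \<open>Expectations\<close>

text \<open>Works coordinatewise: for independent real variables, integrability of both factors
  already makes the product integrable, with the product of the means as its mean.\<close>

lemma (in prob_space) indep_inner:
  fixes w h :: "'a \<Rightarrow> 'b::euclidean_space"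
  assumes indep: "indep_set (sets (vimage_algebra (space M) w borel)) (sets N)"
    and N: "space N = space M" and h: "h \<in> borel_measurable N"
    and int_w: "integrable M w" and int_h: "integrable M h"
  shows "integrable M (\<lambda>\<omega>. h \<omega> \<bullet> w \<omega>)"
    and "(\<integral>\<omega>. h \<omega> \<bullet> w \<omega> \<partial>M) = (\<integral>\<omega>. h \<omega> \<partial>M) \<bullet> (\<integral>\<omega>. w \<omega> \<partial>M)"
proof -
  let ?W = "vimage_algebra (space M) w borel"
  have comp: "indep_var borel (\<lambda>\<omega>. w \<omega> \<bullet> b) borel (\<lambda>\<omega>. h \<omega> \<bullet> b)" for b
  proof -
    have "w \<in> borel_measurable ?W" by (rule measurable_vimage_algebra1) simp
    then have wb: "(\<lambda>\<omega>. w \<omega> \<bullet> b) \<in> borel_measurable ?W" by measurable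
    have hb: "(\<lambda>\<omega>. h \<omega> \<bullet> b) \<in> borel_measurable N" using h by measurable
    \<comment> \<open>The sigma-algebra generated by a coordinate lies inside the given one, and
      independence passes to smaller families.\<close>
    have "{(\<lambda>\<omega>. w \<omega> \<bullet> b) -` A \<inter> space M |A. A \<in> sets borel} \<subseteq> sets ?W"
      using measurable_sets[OF wb] by auto
    from sets.sigma_sets_subset[OF this]
    have "sigma_sets (space M) {(\<lambda>\<omega>. w \<omega> \<bullet> b) -` A \<inter> space M |A. A \<in> sets borel} \<subseteq> sets ?W"
      by simp
    moreover have "{(\<lambda>\<omega>. h \<omega> \<bullet> b) -` A \<inter> space M |A. A \<in> sets borel} \<subseteq> sets N"
      using measurable_sets[OF hb] N by auto
    from sets.sigma_sets_subset[OF this]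
    have "sigma_sets (space M) {(\<lambda>\<omega>. h \<omega> \<bullet> b) -` A \<inter> space M |A. A \<in> sets borel} \<subseteq> sets N"
      by (simp add: N)
    ultimately have "indep_set
        (sigma_sets (space M) {(\<lambda>\<omega>. w \<omega> \<bullet> b) -` A \<inter> space M |A. A \<in> sets borel})
        (sigma_sets (space M) {(\<lambda>\<omega>. h \<omega> \<bullet> b) -` A \<inter> space M |A. A \<in> sets borel})"
      using indep unfolding indep_sets2_eq by (meson subsetD subset_trans)
    moreover have "(\<lambda>\<omega>. w \<omega> \<bullet> b) \<in> borel_measurable M" "(\<lambda>\<omega>. h \<omega> \<bullet> b) \<in> borel_measurable M"
      using int_w int_h by auto
    ultimately show ?thesis
      unfolding indep_var_eq by blast
  qed
  have inner_sum: "h \<omega> \<bullet> w \<omega> = (\<Sum>b\<in>Basis. (w \<omega> \<bullet> b) * (h \<omega> \<bullet> b))" for \<omega>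
    by (simp add: euclidean_inner[of "h \<omega>" "w \<omega>"] mult.commute)
  have "integrable M (\<lambda>\<omega>. (w \<omega> \<bullet> b) * (h \<omega> \<bullet> b))" for b
    using int_w int_h by (intro indep_var_integrable[OF comp]) auto
  moreover have "(\<integral>\<omega>. (w \<omega> \<bullet> b) * (h \<omega> \<bullet> b) \<partial>M) = ((\<integral>\<omega>. w \<omega> \<partial>M) \<bullet> b) * ((\<integral>\<omega>. h \<omega> \<partial>M) \<bullet> b)" for b
    using int_w int_h by (subst indep_var_lebesgue_integral[OF comp]) auto
  ultimately show "integrable M (\<lambda>\<omega>. h \<omega> \<bullet> w \<omega>)"
    and "(\<integral>\<omega>. h \<omega> \<bullet> w \<omega> \<partial>M) = (\<integral>\<omega>. h \<omega> \<partial>M) \<bullet> (\<integral>\<omega>. w \<omega> \<partial>M)"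
    unfolding inner_sum by (simp_all add: euclidean_inner[of "\<integral>\<omega>. h \<omega> \<partial>M" "\<integral>\<omega>. w \<omega> \<partial>M"] mult.commute)
qed

section \<open>Square integrability and second moments\<close>

text \<open>The invariant carried along the iteration: it is preserved by a step, and it makes V
  integrable because V grows at most quadratically.\<close>

definition square_integrable :: "'a measure \<Rightarrow> ('a \<Rightarrow> 'b::euclidean_space) \<Rightarrow> bool" where
  "square_integrable M X \<longleftrightarrow> X \<in> borel_measurable M \<and> integrable M (\<lambda>\<omega>. (norm (X \<omega>))\<^sup>2)"

lemma square_integrable_bound:
  assumes X: "square_integrable M X" and Y: "Y \<in> borel_measurable M"
    and le: "\<And>\<omega>. \<omega> \<in> space M \<Longrightarrow> norm (Y \<omega>) \<le> K * norm (X \<omega>)"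
  shows "square_integrable M Y"
  unfolding square_integrable_def
proof
  show "integrable M (\<lambda>\<omega>. (norm (Y \<omega>))\<^sup>2)"
  proof (rule Bochner_Integration.integrable_bound[where f = "\<lambda>\<omega>. K\<^sup>2 * (norm (X \<omega>))\<^sup>2"])
    show "AE \<omega> in M. norm ((norm (Y \<omega>))\<^sup>2) \<le> norm (K\<^sup>2 * (norm (X \<omega>))\<^sup>2)"
      using power_mono[OF le, of _ 2] by (intro AE_I2) (simp add: power_mult_distrib)
  qed (use X Y in \<open>auto simp: square_integrable_def\<close>)
qed (rule Y)

lemma square_integrable_add:
  assumes X: "square_integrable M X" and Y: "square_integrable M Y"
  shows "square_integrable M (\<lambda>\<omega>. X \<omega> + Y \<omega>)"
  unfolding square_integrable_def
proof
  show meas: "(\<lambda>\<omega>. X \<omega> + Y \<omega>) \<in> borel_measurable M"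
    using X Y unfolding square_integrable_def by (intro borel_measurable_add) auto
  show "integrable M (\<lambda>\<omega>. (norm (X \<omega> + Y \<omega>))\<^sup>2)"
  proof (rule Bochner_Integration.integrable_bound[where f = "\<lambda>\<omega>. 2 * (norm (X \<omega>))\<^sup>2 + 2 * (norm (Y \<omega>))\<^sup>2"])
    have "(norm (a + b))\<^sup>2 \<le> 2 * (norm a)\<^sup>2 + 2 * (norm b)\<^sup>2" for a b :: 'b
      using inner_ge_zero[of "a - b"]
      by (simp add: power2_norm_eq_inner inner_add_left inner_add_right inner_diff_left
          inner_diff_right inner_commute)
    then show "AE \<omega> in M. norm ((norm (X \<omega> + Y \<omega>))\<^sup>2) \<le> norm (2 * (norm (X \<omega>))\<^sup>2 + 2 * (norm (Y \<omega>))\<^sup>2)"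
      by (intro AE_I2) simp
  qed (use X Y meas in \<open>auto simp: square_integrable_def\<close>)
qed

text \<open>Constants are integrable on a probability space, so 1 + |X|^2 is an integrable bound for
  |X|.\<close>

lemma (in prob_space) square_integrable_imp_integrable:
  assumes "square_integrable M X"
  shows "integrable M X"
proof (rule Bochner_Integration.integrable_bound[where f = "\<lambda>\<omega>. 1 + (norm (X \<omega>))\<^sup>2"])
  have "norm a \<le> 1 + (norm a)\<^sup>2" for a :: 'b
    using sum_power2_ge_zero[of "norm a - 1" "norm a"] by (simp add: power2_eq_square algebra_simps)
  then show "AE \<omega> in M. norm (X \<omega>) \<le> norm (1 + (norm (X \<omega>))\<^sup>2)"
    by (intro AE_I2) simp
qed (use assms in \<open>auto simp: square_integrable_def\<close>)

lemma matrix_vector_mult_borel: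
  fixes A :: "real^'n^'m"
  shows "(\<lambda>v. A *v v) \<in> borel_measurable borel"
  by (intro borel_measurable_continuous_onI linear_continuous_on matrix_vector_mul_bounded_linear)

lemma integrable_vec_nth:
  fixes X :: "'a \<Rightarrow> 'b::euclidean_space^'n"
  assumes "integrable M X"
  shows "integrable M (\<lambda>\<omega>. X \<omega> $ i)" "(\<integral>\<omega>. X \<omega> $ i \<partial>M) = (\<integral>\<omega>. X \<omega> \<partial>M) $ i"
  using integrable_bounded_linear[OF bounded_linear_vec_nth assms]
    integral_bounded_linear[OF bounded_linear_vec_nth assms] by auto

text \<open>The form is a linear combination of the entries of w w^T, and the expectation of that
  matrix leaves only the diagonal of \<open>Q\<close>. The choices \<open>Q = mat 1\<close> and
  \<open>Q = upper_left_block P\<close> give the factors d and Tr P_11 of the bound.\<close>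

lemma expectation_quadratic_form:
  fixes w :: "'a \<Rightarrow> real^'d" and Q :: "real^'d^'d"
  assumes int: "integrable M (\<lambda>\<omega>. outer (w \<omega>) (w \<omega>))"
    and cov: "(\<integral>\<omega>. outer (w \<omega>) (w \<omega>) \<partial>M) = s *\<^sub>R mat 1"
  shows "integrable M (\<lambda>\<omega>. w \<omega> \<bullet> (Q *v w \<omega>))"
    and "(\<integral>\<omega>. w \<omega> \<bullet> (Q *v w \<omega>) \<partial>M) = s * trace Q"
proof -
  have eq: "w \<omega> \<bullet> (Q *v w \<omega>) = (\<Sum>i\<in>UNIV. \<Sum>j\<in>UNIV. Q $ i $ j * outer (w \<omega>) (w \<omega>) $ i $ j)" for \<omega>
    by (simp add: inner_vec_def matrix_vector_mult_def outer_def sum_distrib_left mult_ac)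
  have int2: "integrable M (\<lambda>\<omega>. outer (w \<omega>) (w \<omega>) $ i $ j)" for i j
    using int by (intro integrable_vec_nth)
  have val: "(\<integral>\<omega>. outer (w \<omega>) (w \<omega>) $ i $ j \<partial>M) = s * (if i = j then 1 else 0)" for i j
    using int by (subst integrable_vec_nth(2), auto intro: integrable_vec_nth(1)
        simp: integrable_vec_nth(2) cov mat_def)
  show "integrable M (\<lambda>\<omega>. w \<omega> \<bullet> (Q *v w \<omega>))"
    unfolding eq using int2 by auto
  show "(\<integral>\<omega>. w \<omega> \<bullet> (Q *v w \<omega>) \<partial>M) = s * trace Q"
    unfolding eq using int2
    by (simp add: val trace_def sum_distrib_left mult_ac if_distrib[where f = "\<lambda>a. _ * a"] cong: if_cong)
qed

lemma square_integrable_mult: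
  fixes A :: "real^'n^'m"
  assumes "square_integrable M X"
  shows "square_integrable M (\<lambda>\<omega>. A *v X \<omega>)"
proof (rule square_integrable_bound[OF assms])
  show "(\<lambda>\<omega>. A *v X \<omega>) \<in> borel_measurable M"
    using assms by (intro measurable_compose[OF _ matrix_vector_mult_borel])
      (simp add: square_integrable_def)
  show "norm (A *v X \<omega>) \<le> onorm ((*v) A) * norm (X \<omega>)" for \<omega>
    by (rule onorm[OF matrix_vector_mul_bounded_linear])
qed

text \<open>The gradient vanishes at \<open>xs\<close>, so its norm is at most a multiple of the
  distance to \<open>xs\<close>; hence the assumption on \<open>X \<omega> - xs\<close>.\<close>

lemma square_integrable_grad:
  assumes f: "f \<in> smooth_strongly_convex \<mu> L" and mu: "0 < \<mu>" "\<mu> \<le> L"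
    and min: "\<And>z. f xs \<le> f z"
    and X: "square_integrable M (\<lambda>\<omega>. X \<omega> - xs)"
  shows "square_integrable M (\<lambda>\<omega>. grad f (X \<omega>))"
proof (rule square_integrable_bound[OF X])
  have "(\<lambda>\<omega>. (X \<omega> - xs) + xs) \<in> borel_measurable M"
    using X unfolding square_integrable_def by (intro borel_measurable_add) auto
  then show "(\<lambda>\<omega>. grad f (X \<omega>)) \<in> borel_measurable M"
    by (intro measurable_compose[OF _ smooth_strongly_convex_borel(2)[OF f]]) simp
  show "norm (grad f (X \<omega>)) \<le> (\<mu> + L) * norm (X \<omega> - xs)" for \<omega>
    using norm_grad_le[OF f mu, of "X \<omega>" xs] grad_minimizer[OF f _ min] mu by simp
qed

lemma (in prob_space) square_integrable_const: "square_integrable M (\<lambda>_. a)"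
  by (simp add: square_integrable_def)

lemma square_integrable_scaleR:
  assumes "square_integrable M X"
  shows "square_integrable M (\<lambda>\<omega>. a *\<^sub>R X \<omega>)"
  using assms by (intro square_integrable_bound[OF assms, where K = "\<bar>a\<bar>"])
    (auto simp: square_integrable_def)

lemma (in prob_space) square_integrable_diff_const:
  assumes "square_integrable M X"
  shows "square_integrable M (\<lambda>\<omega>. X \<omega> - a)"
  using square_integrable_add[OF assms square_integrable_const[of "- a"]] by simp

section \<open>Growth, measurability and integrability of V\<close>

text \<open>Writing the projection as a matrix product reduces its measurability to that of matrix
  multiplication.\<close>

lemma upper_block_eq_sys_C: "upper_block (z :: real^('d + 'd::finite)) = sys_C 0 *v z"
  by (rule vstack_cases[of z]) (simp add: sys_C_mult)

lemma V_fun_nonneg: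
  assumes "psd P" "0 \<le> c" "\<And>x. f xs \<le> f x"
  shows "0 \<le> V_fun f xs P c z"
  using assms by (simp add: V_fun_def Let_def psd_def)

text \<open>The quadratic upper bound based at \<open>xs\<close> has no linear term. Together with
  \<open>V_fun_nonneg\<close> this yields the domination that makes V integrable.\<close>

lemma V_fun_le:
  assumes f: "f \<in> smooth_strongly_convex \<mu> L" and "0 < L" "0 \<le> c" and min: "\<And>x. f xs \<le> f x"
  shows "V_fun f xs P c z \<le> (onorm ((*v) P) + c * L / 2) * (norm (z - vstack xs xs))\<^sup>2"
proof -
  let ?z = "z - vstack xs xs"
  have "?z \<bullet> (P *v ?z) \<le> norm ?z * norm (P *v ?z)"
    by (rule norm_cauchy_schwarz)
  also have "\<dots> \<le> norm ?z * (onorm ((*v) P) * norm ?z)"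
    by (intro mult_left_mono onorm[OF matrix_vector_mul_bounded_linear]) simp
  finally have quad: "?z \<bullet> (P *v ?z) \<le> onorm ((*v) P) * (norm ?z)\<^sup>2"
    by (simp add: power2_eq_square mult_ac)
  have ub: "upper_block ?z = upper_block z - xs"
    by (simp add: upper_block_def vec_eq_iff)
  have "f (upper_block z) - f xs \<le> L / 2 * (norm (upper_block ?z))\<^sup>2"
    using smooth_strongly_convexD(1)[OF f, of "upper_block z" xs] grad_minimizer[OF f \<open>0 < L\<close> min]
    by (simp add: ub power2_norm_eq_inner)
  also have "\<dots> \<le> L / 2 * (norm ?z)\<^sup>2"
    using \<open>0 < L\<close> by (intro mult_left_mono power_mono norm_upper_block_le) auto
  finally have "c * (f (upper_block z) - f xs) \<le> c * (L / 2 * (norm ?z)\<^sup>2)"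
    using \<open>0 \<le> c\<close> by (rule mult_left_mono)
  with quad show ?thesis
    by (simp add: V_fun_def Let_def algebra_simps)
qed

lemma V_fun_borel:
  assumes "f \<in> smooth_strongly_convex \<mu> L"
  shows "V_fun f xs P c \<in> borel_measurable borel"
proof -
  note [measurable] = smooth_strongly_convex_borel(1)[OF assms] matrix_vector_mult_borel
  show ?thesis
    unfolding V_fun_def Let_def upper_block_eq_sys_C by measurable
qed

lemma (in prob_space) integrable_V_fun:
  assumes f: "f \<in> smooth_strongly_convex \<mu> L" and "0 < L" "0 \<le> c" "psd P"
    and min: "\<And>x. f xs \<le> f x" and Z: "square_integrable M Z"
  shows "integrable M (\<lambda>\<omega>. V_fun f xs P c (Z \<omega>))"
proof (rule Bochner_Integration.integrable_bound
    [where f = "\<lambda>\<omega>. (onorm ((*v) P) + c * L / 2) * (norm (Z \<omega> - vstack xs xs))\<^sup>2"])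
  show "integrable M (\<lambda>\<omega>. (onorm ((*v) P) + c * L / 2) * (norm (Z \<omega> - vstack xs xs))\<^sup>2)"
    using square_integrable_diff_const[OF Z] by (simp add: square_integrable_def)
  show "(\<lambda>\<omega>. V_fun f xs P c (Z \<omega>)) \<in> borel_measurable M"
    using Z by (intro measurable_compose[OF _ V_fun_borel[OF f]]) (simp add: square_integrable_def)
  show "AE \<omega> in M. norm (V_fun f xs P c (Z \<omega>))
      \<le> norm ((onorm ((*v) P) + c * L / 2) * (norm (Z \<omega> - vstack xs xs))\<^sup>2)"
    using V_fun_nonneg[OF \<open>psd P\<close> \<open>0 \<le> c\<close>, of f xs] V_fun_le[OF f \<open>0 < L\<close> \<open>0 \<le> c\<close> min, of P] min
    by (intro AE_I2) (simp add: order_trans[OF _ abs_ge_self])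
qed

lemma agd_borel:
  assumes "f \<in> smooth_strongly_convex \<mu> L"
  shows "agd_map f \<alpha> \<beta> \<in> borel_measurable borel"
    and "noise_coeff f xs L' \<alpha> \<beta> P c \<in> borel_measurable borel"
proof -
  note [measurable] = smooth_strongly_convex_borel(2)[OF assms] matrix_vector_mult_borel
  show [measurable]: "agd_map f \<alpha> \<beta> \<in> borel_measurable borel"
    unfolding agd_map_def by measurable
  show "noise_coeff f xs L' \<alpha> \<beta> P c \<in> borel_measurable borel"
    unfolding noise_coeff_def by measurable
qed

lemma (in prob_space) square_integrable_agd:
  assumes f: "f \<in> smooth_strongly_convex \<mu> L" and mu: "0 < \<mu>" "\<mu> \<le> L"
    and min: "\<And>x. f xs \<le> f x" and Z: "square_integrable M Z"
  shows "square_integrable M (\<lambda>\<omega>. agd_map f \<alpha> \<beta> (Z \<omega>))"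
    and "square_integrable M (\<lambda>\<omega>. noise_coeff f xs L' \<alpha> \<beta> P c (Z \<omega>))"
proof -
  have G: "square_integrable M (\<lambda>\<omega>. grad f (sys_C \<beta> *v Z \<omega>))"
    by (intro square_integrable_grad[OF f mu min] square_integrable_diff_const
        square_integrable_mult Z)
  show A: "square_integrable M (\<lambda>\<omega>. agd_map f \<alpha> \<beta> (Z \<omega>))"
    unfolding agd_map_def by (intro square_integrable_add square_integrable_mult Z G)
  show "square_integrable M (\<lambda>\<omega>. noise_coeff f xs L' \<alpha> \<beta> P c (Z \<omega>))"
    unfolding noise_coeff_def
    by (intro square_integrable_add square_integrable_scaleR square_integrable_mult
        square_integrable_diff_const A G)
qed

section \<open>The expected step and its iteration\<close>

text \<open>Integrates \<open>V_fun_step\<close>. \<open>N\<close> stands for the past of the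
  process: the noise coefficient is a function of \<open>Z\<close>, hence measurable for
  \<open>N\<close> and independent of \<open>w\<close>. Square integrability of the new state is
  concluded as well, so that the step can be repeated.\<close>

lemma (in prob_space) expected_V_fun_step:
  fixes w :: "'a \<Rightarrow> real^'d" and Z :: "'a \<Rightarrow> real^('d + 'd)"
  assumes mu: "0 < \<mu>" "\<mu> \<le> L" and f: "f \<in> smooth_strongly_convex \<mu> L"
    and min: "\<And>x. f xs \<le> f x" and P: "psd P" and \<rho>: "0 < \<rho>" "\<rho> < 1" and c: "0 \<le> c0" "0 \<le> c"
    and LMI: "c0 *\<^sub>R X0_mat \<mu> L \<beta> + c *\<^sub>R X_mat \<mu> L \<alpha> \<beta> \<rho> \<succeq> Phi (sys_A \<beta>) (sys_B \<alpha>) P \<rho>"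
    and w: "integrable M w" "(\<integral>\<omega>. w \<omega> \<partial>M) = 0"
    and outer: "integrable M (\<lambda>\<omega>. outer (w \<omega>) (w \<omega>))"
      "(\<integral>\<omega>. outer (w \<omega>) (w \<omega>) \<partial>M) = \<sigma>\<^sup>2 *\<^sub>R mat 1"
    and indep: "indep_set (sets (vimage_algebra (space M) w borel)) (sets N)"
    and N: "space N = space M" "Z \<in> borel_measurable N"
    and Z: "square_integrable M Z"
  defines "Z' \<equiv> \<lambda>\<omega>. agd_map f \<alpha> \<beta> (Z \<omega>) + sys_B \<alpha> *v w \<omega>"
  shows "square_integrable M Z'"
    and "(\<integral>\<omega>. V_fun f xs P c (Z' \<omega>) \<partial>M) \<le> \<rho>\<^sup>2 * (\<integral>\<omega>. V_fun f xs P c (Z \<omega>) \<partial>M)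
      + \<sigma>\<^sup>2 * \<alpha>\<^sup>2 * (c / 2 * L * real CARD('d) + trace (upper_left_block P))"
proof -
  have "0 < L" using mu by simp
  note V_int = integrable_V_fun[OF f \<open>0 < L\<close> c(2) P min]
  \<comment> \<open>As a quadratic form with identity matrix, the squared norm is covered by the
    same expectation lemma as the P_11 term.\<close>
  have norm_w: "w \<omega> \<bullet> w \<omega> = w \<omega> \<bullet> (mat 1 *v w \<omega>)" for \<omega> by simp
  have ww: "integrable M (\<lambda>\<omega>. w \<omega> \<bullet> w \<omega>)" "(\<integral>\<omega>. w \<omega> \<bullet> w \<omega> \<partial>M) = \<sigma>\<^sup>2 * real CARD('d)"
    unfolding norm_w using expectation_quadratic_form[OF outer, of "mat 1"]
    by (simp_all add: trace_def mat_def)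
  have "square_integrable M w"
    using w(1) ww(1) by (simp add: square_integrable_def power2_norm_eq_inner)
  then show Z': "square_integrable M Z'"
    unfolding Z'_def
    by (intro square_integrable_add square_integrable_mult square_integrable_agd[OF f mu min] Z)
  define h where "h \<omega> = noise_coeff f xs L \<alpha> \<beta> P c (Z \<omega>)" for \<omega>
  have "h \<in> borel_measurable N"
    unfolding h_def by (rule measurable_compose[OF N(2) agd_borel(2)[OF f]])
  moreover have "integrable M h"
    unfolding h_def by (intro square_integrable_imp_integrable square_integrable_agd[OF f mu min] Z)
  ultimately have hw: "integrable M (\<lambda>\<omega>. h \<omega> \<bullet> w \<omega>)" "(\<integral>\<omega>. h \<omega> \<bullet> w \<omega> \<partial>M) = 0"
    using indep_inner[OF indep N(1) _ w(1)] w(2) by simp_all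
  note Q = expectation_quadratic_form[OF outer, of "upper_left_block P"]
  have "(\<integral>\<omega>. V_fun f xs P c (Z' \<omega>) \<partial>M) \<le> (\<integral>\<omega>. \<rho>\<^sup>2 * V_fun f xs P c (Z \<omega>) + h \<omega> \<bullet> w \<omega>
      + \<alpha>\<^sup>2 * (c / 2 * L * (w \<omega> \<bullet> w \<omega>) + w \<omega> \<bullet> (upper_left_block P *v w \<omega>)) \<partial>M)"
    unfolding Z'_def h_def
    by (intro integral_mono V_fun_step[OF mu f min P \<rho> c LMI] V_int[OF Z'[unfolded Z'_def]]
        Bochner_Integration.integrable_add integrable_mult_right V_int[OF Z] hw(1)[unfolded h_def] ww Q)
  also have "\<dots> = \<rho>\<^sup>2 * (\<integral>\<omega>. V_fun f xs P c (Z \<omega>) \<partial>M)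
      + \<alpha>\<^sup>2 * (c / 2 * L * (\<sigma>\<^sup>2 * real CARD('d)) + \<sigma>\<^sup>2 * trace (upper_left_block P))"
    using V_int[OF Z] hw ww Q by simp
  finally show "(\<integral>\<omega>. V_fun f xs P c (Z' \<omega>) \<partial>M) \<le> \<rho>\<^sup>2 * (\<integral>\<omega>. V_fun f xs P c (Z \<omega>) \<partial>M)
      + \<sigma>\<^sup>2 * \<alpha>\<^sup>2 * (c / 2 * L * real CARD('d) + trace (upper_left_block P))"
    by (simp add: algebra_simps)
qed

text \<open>For positive \<open>k\<close> the state is a coordinate of the joint vector that
  generates the sigma-algebra; for \<open>k = 0\<close> the index set \<open>{1..k}\<close> is
  empty.\<close>

lemma measurable_past_state:
  fixes k :: nat and \<xi> :: "nat \<Rightarrow> 'a \<Rightarrow> 'b::topological_space" and y :: "nat \<Rightarrow> 'a \<Rightarrow> 'c::topological_space"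
  assumes "1 \<le> k"
  shows "\<xi> k \<in> borel_measurable (vimage_algebra S (\<lambda>\<omega>. \<lambda>i\<in>{1..k}. (\<xi> i \<omega>, y i \<omega>))
    (Pi\<^sub>M {1..k} (\<lambda>_. borel \<Otimes>\<^sub>M borel)))" (is "_ \<in> borel_measurable ?N")
proof -
  have "(\<lambda>\<omega>. \<lambda>i\<in>{1..k}. (\<xi> i \<omega>, y i \<omega>)) \<in> ?N \<rightarrow>\<^sub>M Pi\<^sub>M {1..k} (\<lambda>_. borel \<Otimes>\<^sub>M borel)"
    by (rule measurable_vimage_algebra1) (simp add: space_PiM space_pair_measure)
  then have "(\<lambda>\<omega>. (\<lambda>i\<in>{1..k}. (\<xi> i \<omega>, y i \<omega>)) k) \<in> ?N \<rightarrow>\<^sub>M borel \<Otimes>\<^sub>M borel"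
    by (rule measurable_compose) (use assms in \<open>auto intro: measurable_component_singleton\<close>)
  from measurable_compose[OF this measurable_fst] assms show ?thesis by simp
qed

theorem proposition4p6:
  fixes f :: "real^'d \<Rightarrow> real"
    and xstar x0 xm1 :: "real^'d"
    and \<mu> L \<alpha> \<beta> \<sigma> \<rho> c0 c :: real
    and M :: "'a measure"
    and x :: "int \<Rightarrow> 'a \<Rightarrow> real^'d"
    and y w :: "nat \<Rightarrow> 'a \<Rightarrow> real^'d"
    and \<xi> :: "nat \<Rightarrow> 'a \<Rightarrow> real^('d + 'd)"
    and P :: "real^('d + 'd)^('d + 'd)"
  assumes "0 < \<mu>" and "\<mu> \<le> L"
    and "f \<in> smooth_strongly_convex \<mu> L"
    and "\<And>z. f xstar \<le> f z"
    and "prob_space M"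
    and "\<And>\<omega>. \<omega> \<in> space M \<Longrightarrow> x 0 \<omega> = x0"
    and "\<And>\<omega>. \<omega> \<in> space M \<Longrightarrow> x (- 1) \<omega> = xm1"
    and "\<And>k \<omega>. \<omega> \<in> space M \<Longrightarrow>
           y k \<omega> = (1 + \<beta>) *\<^sub>R x (int k) \<omega> - \<beta> *\<^sub>R x (int k - 1) \<omega>"
    and "\<And>k \<omega>. \<omega> \<in> space M \<Longrightarrow>
           x (int k + 1) \<omega> = y k \<omega> - \<alpha> *\<^sub>R (grad f (y k \<omega>) + w k \<omega>)"
    and "\<And>k \<omega>. \<omega> \<in> space M \<Longrightarrow> \<xi> k \<omega> = vstack (x (int k) \<omega>) (x (int k - 1) \<omega>)"
    and "0 < \<sigma>" and "noise M \<sigma> \<xi> y w"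
    and "0 < \<rho>" and "\<rho> < 1" and "psd P" and "0 \<le> c0" and "0 \<le> c"
    and "c0 *\<^sub>R X0_mat \<mu> L \<beta> + c *\<^sub>R X_mat \<mu> L \<alpha> \<beta> \<rho> \<succeq> Phi (sys_A \<beta>) (sys_B \<alpha>) P \<rho>"
  shows "\<forall>k. integrable M (\<lambda>\<omega>. V_fun f xstar P c (\<xi> k \<omega>)) \<and>
    (\<integral>\<omega>. V_fun f xstar P c (\<xi> k \<omega>) \<partial>M)
      \<le> \<rho> ^ (2 * k) * V_fun f xstar P c (vstack x0 xm1)
        + (1 - \<rho> ^ (2 * k)) / (1 - \<rho>\<^sup>2) * \<sigma>\<^sup>2 * \<alpha>\<^sup>2
          * (c / 2 * L * real CARD('d) + trace (upper_left_block P))"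
proof -
  interpret prob_space M by fact
  let ?V = "V_fun f xstar P c"
  let ?K = "\<sigma>\<^sup>2 * \<alpha>\<^sup>2 * (c / 2 * L * real CARD('d) + trace (upper_left_block P))"
  have noise: "integrable M (w k)" "(\<integral>\<omega>. w k \<omega> \<partial>M) = 0"
    "integrable M (\<lambda>\<omega>. outer (w k \<omega>) (w k \<omega>))"
    "(\<integral>\<omega>. outer (w k \<omega>) (w k \<omega>) \<partial>M) = \<sigma>\<^sup>2 *\<^sub>R mat 1"
    "indep_set (sets (vimage_algebra (space M) (w k) borel))
       (sets (vimage_algebra (space M) (\<lambda>\<omega>. \<lambda>i\<in>{1..k}. (\<xi> i \<omega>, y i \<omega>))
         (Pi\<^sub>M {1..k} (\<lambda>_. borel \<Otimes>\<^sub>M borel))))" for k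
    using \<open>noise M \<sigma> \<xi> y w\<close> unfolding noise_def by blast+
  have \<xi>0: "\<xi> 0 \<omega> = vstack x0 xm1" if "\<omega> \<in> space M" for \<omega>
    using assms(6,7,10)[OF that] by (simp add: assms(10)[OF that])
  have \<xi>_Suc: "\<xi> (Suc k) \<omega> = agd_map f \<alpha> \<beta> (\<xi> k \<omega>) + sys_B \<alpha> *v w k \<omega>"
    if "\<omega> \<in> space M" for k \<omega>
  proof -
    have C: "sys_C \<beta> *v \<xi> k \<omega> = y k \<omega>"
      by (simp add: assms(8,10)[OF that] sys_C_mult)
    have A: "sys_A \<beta> *v \<xi> k \<omega> = vstack (y k \<omega>) (x (int k) \<omega>)"
      by (simp add: assms(8,10)[OF that] sys_A_mult)
    have "\<xi> (Suc k) \<omega> = vstack (y k \<omega> - \<alpha> *\<^sub>R (grad f (y k \<omega>) + w k \<omega>)) (x (int k) \<omega>)"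
      using assms(10)[OF that, of "Suc k"] assms(9)[OF that, of k] by (simp add: add.commute)
    then show ?thesis
      by (simp add: agd_map_def A C sys_B_mult vstack_add scaleR_add_right diff_diff_eq)
  qed
  have \<xi>_meas: "\<xi> k \<in> borel_measurable (vimage_algebra (space M) (\<lambda>\<omega>. \<lambda>i\<in>{1..k}. (\<xi> i \<omega>, y i \<omega>))
      (Pi\<^sub>M {1..k} (\<lambda>_. borel \<Otimes>\<^sub>M borel)))" for k
  proof (cases "k = 0")
    case True
    \<comment> \<open>The sigma-algebra is trivial here, but the initial state is deterministic, and
      a constant is measurable for it.\<close>
    then show ?thesis using \<xi>0 by (subst measurable_cong[where g = "\<lambda>_. vstack x0 xm1"]) auto
  next
    case False
    then show ?thesis by (intro measurable_past_state) simp
  qed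
  have step: "square_integrable M (\<xi> (Suc k)) \<and>
      (\<integral>\<omega>. ?V (\<xi> (Suc k) \<omega>) \<partial>M) \<le> \<rho>\<^sup>2 * (\<integral>\<omega>. ?V (\<xi> k \<omega>) \<partial>M) + ?K"
    if "square_integrable M (\<xi> k)" for k
  proof -
    note next_state = expected_V_fun_step[OF assms(1-4,15,13,14,16-18) noise _ \<xi>_meas that]
    \<comment> \<open>The recursion is known only on \<open>space M\<close>, so the conclusions
      about the explicit step are transferred by congruence.\<close>
    have "square_integrable M (\<xi> (Suc k)) \<longleftrightarrow>
        square_integrable M (\<lambda>\<omega>. agd_map f \<alpha> \<beta> (\<xi> k \<omega>) + sys_B \<alpha> *v w k \<omega>)"
      unfolding square_integrable_def
      by (intro conj_cong measurable_cong Bochner_Integration.integrable_cong) (simp_all add: \<xi>_Suc)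
    moreover have "(\<integral>\<omega>. ?V (\<xi> (Suc k) \<omega>) \<partial>M)
        = (\<integral>\<omega>. ?V (agd_map f \<alpha> \<beta> (\<xi> k \<omega>) + sys_B \<alpha> *v w k \<omega>) \<partial>M)"
      by (rule Bochner_Integration.integral_cong) (simp_all add: \<xi>_Suc)
    ultimately show ?thesis using next_state by simp
  qed
  have sq: "square_integrable M (\<xi> k)" for k
  proof (induction k)
    case 0
    have "square_integrable M (\<xi> 0) \<longleftrightarrow> square_integrable M (\<lambda>_. vstack x0 xm1)"
      unfolding square_integrable_def
      by (intro conj_cong measurable_cong Bochner_Integration.integrable_cong) (simp_all add: \<xi>0)
    then show ?case using square_integrable_const by blast
  qed (use step in blast)
  have bound: "(\<integral>\<omega>. ?V (\<xi> k \<omega>) \<partial>M)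
      \<le> \<rho> ^ (2 * k) * ?V (vstack x0 xm1) + (1 - \<rho> ^ (2 * k)) / (1 - \<rho>\<^sup>2) * ?K" for k
  proof (induction k)
    case 0
    have "(\<integral>\<omega>. ?V (\<xi> 0 \<omega>) \<partial>M) = (\<integral>\<omega>. ?V (vstack x0 xm1) \<partial>M)"
      by (rule Bochner_Integration.integral_cong) (simp_all add: \<xi>0)
    then show ?case by (simp add: prob_space)
  next
    case (Suc k)
    have "\<rho>\<^sup>2 < 1" using assms(13,14) by (simp add: power_less_one_iff)
    \<comment> \<open>The partial geometric sums a_k satisfy \<rho>^2 a_k + 1 = a_(k+1); the
      division is legitimate since \<rho>^2 < 1.\<close>
    then have geometric: "\<rho>\<^sup>2 * ((1 - \<rho> ^ (2 * k)) / (1 - \<rho>\<^sup>2)) + 1 = (1 - \<rho> ^ (2 * Suc k)) / (1 - \<rho>\<^sup>2)"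
      by (simp add: field_simps power2_eq_square)
    have "(\<integral>\<omega>. ?V (\<xi> (Suc k) \<omega>) \<partial>M) \<le> \<rho>\<^sup>2 * (\<integral>\<omega>. ?V (\<xi> k \<omega>) \<partial>M) + ?K"
      using step[OF sq] by blast
    also have "\<dots> \<le> \<rho>\<^sup>2 * (\<rho> ^ (2 * k) * ?V (vstack x0 xm1)
        + (1 - \<rho> ^ (2 * k)) / (1 - \<rho>\<^sup>2) * ?K) + ?K"
      by (intro add_right_mono mult_left_mono Suc.IH) simp
    also have "\<dots> = \<rho> ^ (2 * Suc k) * ?V (vstack x0 xm1)
        + (\<rho>\<^sup>2 * ((1 - \<rho> ^ (2 * k)) / (1 - \<rho>\<^sup>2)) + 1) * ?K"
    proof -
      \<comment> \<open>Stated for arbitrary reals, which keeps the powers and the quotient opaque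
        during the rearrangement.\<close>
      have "r * (p * v + q * K) + K = (r * p) * v + (r * q + 1) * K" for r p v q K :: real
        by (simp add: algebra_simps)
      moreover have "\<rho> ^ (2 * Suc k) = \<rho>\<^sup>2 * \<rho> ^ (2 * k)"
        by (simp add: power2_eq_square)
      ultimately show ?thesis by metis
    qed
    finally show ?case unfolding geometric .
  qed
  have "0 < L" using assms(1,2) by simp
  then show ?thesis
    using bound integrable_V_fun[OF assms(3) _ assms(17,15,4) sq] by (simp add: mult.assoc)
qed

end
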